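(* Let $q$ be a prime power, and let $n_t = q^{2^t - 1}$ for every integer $t \geq 1$. For $t\geq 1$, let $H_t(q)$ be a subhypergraph of the affine geometry $AG_{2^t}(q)$ that is induced by the hyperedges of $n_t$ arbitrarily chosen parallel classes. Define $$A_1(q) = K_q, \qquad A_{i+1}(q) = \Gamma(A_i(q), H_i(q)), \quad i \geq 1.$$ Then, for every $t \geq 1$, the graph $A_t(q)$ has order $n_t$ and constant link $tK_{q-1}$. Moreover, the graph $A_t(3)$ is $\{C_4, C_5\}$-free and the graph $A_t(4)$ is $C_5$-free, for every $t \geq 1$.
   Context: All graphs are finite and simple; order means number of vertices. A graph $G$ has constant link $L$ if for every vertex $v$ the subgraph induced by the open neighborhood $N(v)$ is isomorphic to $L$; $tL$ is the disjoint union of $t$ copies of $L$. "$C_\ell$-free" means containing no cycle of length $\ell$ as a (not necessarily induced) subgraph. For $m\ge2$, the affine geometry $AG_m(q)$ is regarded as the $q$-uniform hypergraph with vertex set $\mathbb{F}_q^m$ whose hyperedges are the affine lines ($1$-dimensional affine subspaces). Its lines are partitioned into $\frac{q^m-1}{q-1}$ parallel classes, each consisting of $q^{m-1}$ pairwise disjoint lines covering $\mathbb{F}_q^m$. The hypergraph $H_t(q)$ has vertex set $\mathbb{F}_q^{2^t}$ and as hyperedges all lines of $n_t$ chosen parallel classes; it is $n_t$-regular. Construction of $\Gamma(G,H)$ (with the clique $K_q$): let $G$ be a graph of order $n$ and constant link $sK_{q-1}$ for some $s\ge1$, and $H$ an $n$-regular $q$-uniform hypergraph (every vertex in exactly $n$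 edges, every edge of size $q$) with vertices $x_1,\dots,x_N$. (1) At each vertex $x$ of $H$ enumerate the hyperedges containing $x$ as $E_{x,1},\dots,E_{x,n}$. (2) Take $N$ disjoint copies of $G$ on vertex sets $V_1,\dots,V_N$, $V_i=\{v_{i,1},\dots,v_{i,n}\}$, and set $V(\Gamma)=V_1\cup\dots\cup V_N$. (3) With each edge $E$ of $H$ associate the $q$-element set $f(E)\subseteq V(\Gamma)$ defined by $v_{i,j}\in f(E)$ if and only if $E_{x_i,j}=E$. (4) For each hyperedge $E$ of $H$, place a copy of $K_q$ on the set $f(E)$. The resulting graph (for any choice of the enumerations) is $\Gamma(G,H)$. *)

theory Defs
  imports "HOL-Number_Theory.Prime_Powers" "HOL-Library.Cardinality"
begin

text \<open>Graphs are treated as 2-uniform hypergraphs, so one record serves for both.\<close>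

record 'v hypergraph =
  verts :: "'v set"
  edges :: "'v set set"

definition simple_graph :: "'v hypergraph \<Rightarrow> bool" where
  "simple_graph G \<longleftrightarrow> finite (verts G) \<and> (\<forall>e\<in>edges G. e \<subseteq> verts G \<and> card e = 2)"

definition complete_graph :: "'v set \<Rightarrow> 'v hypergraph" where
  "complete_graph S = \<lparr>verts = S, edges = {e. e \<subseteq> S \<and> card e = 2}\<rparr>"

definition induced_subgraph :: "'v hypergraph \<Rightarrow> 'v set \<Rightarrow> 'v hypergraph" where
  "induced_subgraph G S = \<lparr>verts = verts G \<inter> S, edges = {e \<in> edges G. e \<subseteq> S}\<rparr>"

definition neighborhood :: "'v hypergraph \<Rightarrow> 'v \<Rightarrow> 'v set" where
  "neighborhood G v = {u \<in> verts G. {v, u} \<in> edges G}"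

definition isomorphic :: "'v hypergraph \<Rightarrow> 'w hypergraph \<Rightarrow> bool" where
  "isomorphic G G' \<longleftrightarrow>
     (\<exists>f. bij_betw f (verts G) (verts G') \<and> (\<lambda>e. f ` e) ` edges G = edges G')"

definition disjoint_copies :: "nat \<Rightarrow> 'v hypergraph \<Rightarrow> (nat \<times> 'v) hypergraph" where
  "disjoint_copies t L =
     \<lparr>verts = {..<t} \<times> verts L, edges = (\<Union>k<t. (\<lambda>e. Pair k ` e) ` edges L)\<rparr>"

definition constant_link :: "'v hypergraph \<Rightarrow> 'w hypergraph \<Rightarrow> bool" where
  "constant_link G L \<longleftrightarrow>
     (\<forall>v\<in>verts G. isomorphic (induced_subgraph G (neighborhood G v)) L)"

definition cycle_free :: "nat \<Rightarrow> 'v hypergraph \<Rightarrow> bool" where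
  "cycle_free l G \<longleftrightarrow>
     \<not> (\<exists>c. length c = l \<and> 3 \<le> l \<and> distinct c \<and> set c \<subseteq> verts G \<and>
           (\<forall>i<l. {c ! i, c ! (Suc i mod l)} \<in> edges G))"

text \<open>
  The dimension varies within the construction, so the space of \<open>m\<close>-tuples over the
  finite field \<open>'a\<close> is represented by the sequences vanishing from index \<open>m\<close> on.
\<close>

definition points :: "nat \<Rightarrow> (nat \<Rightarrow> 'a::field) set" where
  "points m = {x. \<forall>i\<ge>m. x i = 0}"

definition line :: "(nat \<Rightarrow> 'a::field) \<Rightarrow> (nat \<Rightarrow> 'a) \<Rightarrow> (nat \<Rightarrow> 'a) set" where
  "line p d = range (\<lambda>c i. p i + c * d i)"

definition AG :: "nat \<Rightarrow> (nat \<Rightarrow> 'a::field) hypergraph" where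
  "AG m = \<lparr>verts = points m,
           edges = {line p d | p d. p \<in> points m \<and> d \<in> points m \<and> d \<noteq> (\<lambda>i. 0)}\<rparr>"

definition parallel :: "nat \<Rightarrow> ((nat \<Rightarrow> 'a::field) set \<times> (nat \<Rightarrow> 'a) set) set" where
  "parallel m = {(L, L'). L \<in> edges (AG m) \<and> L' \<in> edges (AG m) \<and>
                   (\<exists>v\<in>points m. L' = (\<lambda>x i. x i + v i) ` L)}"

definition parallel_classes :: "nat \<Rightarrow> (nat \<Rightarrow> 'a::field) set set set" where
  "parallel_classes m = edges (AG m) // parallel m"

definition induced_by_classes :: "nat \<Rightarrow> nat \<Rightarrow> (nat \<Rightarrow> 'a::field) hypergraph \<Rightarrow> bool" where
  "induced_by_classes m n H \<longleftrightarrow>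
     (\<exists>C. C \<subseteq> parallel_classes m \<and> finite C \<and> card C = n \<and>
          H = \<lparr>verts = points m, edges = \<Union>C\<rparr>)"

text \<open>
  The pair \<open>(x, j)\<close> is the \<open>j\<close>-th vertex of the copy of \<open>G\<close> belonging to the vertex \<open>x\<close>
  of \<open>H\<close>; it copies the vertex \<open>lab x j\<close> of \<open>G\<close>, and \<open>En x j\<close> is the \<open>j\<close>-th hyperedge
  at \<open>x\<close>.
\<close>

definition clique_set ::
  "nat \<Rightarrow> 'p hypergraph \<Rightarrow> ('p \<Rightarrow> nat \<Rightarrow> 'p set) \<Rightarrow> 'p set \<Rightarrow> ('p \<times> nat) set" where
  "clique_set n H En E = {(x, j). x \<in> verts H \<and> j \<in> {1..n} \<and> En x j = E}"

definition Gamma_graph ::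
  "'v hypergraph \<Rightarrow> 'p hypergraph \<Rightarrow> ('p \<Rightarrow> nat \<Rightarrow> 'v) \<Rightarrow> ('p \<Rightarrow> nat \<Rightarrow> 'p set) \<Rightarrow>
     ('p \<times> nat) hypergraph" where
  "Gamma_graph G H lab En =
     (let n = card (verts G) in
      \<lparr>verts = verts H \<times> {1..n},
       edges =
         {{(x, i), (x, j)} | x i j.
            x \<in> verts H \<and> i \<in> {1..n} \<and> j \<in> {1..n} \<and> {lab x i, lab x j} \<in> edges G} \<union>
         (\<Union>E\<in>edges H. edges (complete_graph (clique_set n H En E)))\<rparr>)"

text \<open>
  The bijections \<open>En x\<close> force every vertex of \<open>H\<close> to lie in exactly as many hyperedges
  as \<open>G\<close> has vertices.
\<close>

definition is_Gamma ::
  "'v hypergraph \<Rightarrow> 'p hypergraph \<Rightarrow> ('p \<times> nat) hypergraph \<Rightarrow> bool" where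
  "is_Gamma G H G' \<longleftrightarrow>
     (\<exists>lab En.
        (\<forall>x\<in>verts H. bij_betw (lab x) {1..card (verts G)} (verts G)) \<and>
        (\<forall>x\<in>verts H. bij_betw (En x) {1..card (verts G)} {E \<in> edges H. x \<in> E}) \<and>
        G' = Gamma_graph G H lab En)"

text \<open>
  Since the enumerations are arbitrary, \<open>is_A q H t\<close> is a predicate: it holds of all graphs
  that some choice of enumerations produces as the \<open>t\<close>-th graph.
  The vertex set of the initial \<open>K\<^sub>q\<close> is an arbitrary set of \<open>q\<close> elements.
\<close>

inductive is_A ::
  "nat \<Rightarrow> (nat \<Rightarrow> 'p hypergraph) \<Rightarrow> nat \<Rightarrow> ('p \<times> nat) hypergraph \<Rightarrow> bool"
  for q :: nat and H :: "nat \<Rightarrow> 'p hypergraph" where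
  base: "finite S \<Longrightarrow> card S = q \<Longrightarrow> is_A q H 1 (complete_graph S)"
| step: "is_A q H i G \<Longrightarrow> is_Gamma G (H i) G' \<Longrightarrow> is_A q H (Suc i) G'"

end

theory Submission
  imports Defs
begin

text \<open>
  In \<open>\<Gamma>(G, H)\<close> a vertex is determined by its copy of \<open>G\<close> together with its clique, so its
  link is its link in \<open>G\<close> plus one disjoint \<open>K\<^bsub>q-1\<^esub>\<close>. Since two points of \<open>H\<close> lie on at
  most one hyperedge, a cycle of length 4 or 5 stays inside one copy of \<open>G\<close>, where it is
  excluded inductively, or inside one clique, where it is excluded if \<open>q\<close> is less than its
  length.
\<close>

text \<open>Two demands fix the constants: the degree of \<open>H i\<close> must equal the order n_i
  of A_i, and passing to A_(i+1) multiplies the order by the q^(2^i) points of \<open>H i\<close>.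
  With n_1 = q this gives the exponent 2^i - 1. Dimension m = 2^i is large enough, since there are
  at least q^(m-1) parallel classes. Length 6 is where the cycle argument stops: three copies joined
  in turn by three different cliques, over a triangle of lines, are compatible with linearity. The
  enumerations are arbitrary, so the properties are claimed for every graph satisfying
  \<open>is_A\<close>; that such graphs exist is a separate induction, which uses the order to match
  the degree.\<close>

section \<open>Simple graphs, isomorphisms and cycles in terms of adjacency\<close>

lemma simple_graph_adj_neq:
  assumes "simple_graph G" "{u, v} \<in> edges G"
  shows "u \<noteq> v" "u \<in> verts G" "v \<in> verts G"
  using assms by (auto simp: simple_graph_def)

lemma simple_graph_induced: "simple_graph G \<Longrightarrow> simple_graph (induced_subgraph G S)"
  by (auto simp: simple_graph_def induced_subgraph_def)

lemma simple_graph_complete: "finite S \<Longrightarrow> simple_graph (complete_graph S)"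
  by (auto simp: simple_graph_def complete_graph_def)

lemma complete_graph_adj: "{u, v} \<in> edges (complete_graph S) \<longleftrightarrow> u \<in> S \<and> v \<in> S \<and> u \<noteq> v"
  by (auto simp: complete_graph_def card_2_iff')

lemma simple_graph_disjoint_copies:
  assumes "simple_graph L"
  shows "simple_graph (disjoint_copies t L)"
  unfolding simple_graph_def
proof (intro conjI ballI)
  show "finite (verts (disjoint_copies t L))"
    using assms by (simp add: simple_graph_def disjoint_copies_def)
  fix e assume "e \<in> edges (disjoint_copies t L)"
  then obtain k e0 where e: "k < t" "e0 \<in> edges L" "e = Pair k ` e0"
    by (auto simp: disjoint_copies_def)
  have e0: "e0 \<subseteq> verts L" "card e0 = 2"
    using assms e(2) by (auto simp: simple_graph_def)
  show "e \<subseteq> verts (disjoint_copies t L)"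
    using e e0 by (auto simp: disjoint_copies_def)
  have "inj_on (Pair k) e0"
    by (simp add: inj_on_def)
  then show "card e = 2"
    using e e0 by (simp add: card_image)
qed

lemma disjoint_copies_adj:
  "{x, y} \<in> edges (disjoint_copies t L) \<longleftrightarrow>
    fst x < t \<and> fst x = fst y \<and> {snd x, snd y} \<in> edges L"
proof
  assume "{x, y} \<in> edges (disjoint_copies t L)"
  then obtain k e where k: "k < t" "e \<in> edges L" "{x, y} = Pair k ` e"
    by (auto simp: disjoint_copies_def)
  have "snd ` {x, y} = e"
    unfolding k(3) by (simp add: image_image)
  then have "{snd x, snd y} = e" by simp
  moreover have "fst x = k" "fst y = k"
    using k(3) by (metis fst_conv imageE insertCI)+
  ultimately show "fst x < t \<and> fst x = fst y \<and> {snd x, snd y} \<in> edges L"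
    using k by simp
next
  assume "fst x < t \<and> fst x = fst y \<and> {snd x, snd y} \<in> edges L"
  moreover from this have "{x, y} = Pair (fst x) ` {snd x, snd y}"
    by (cases x; cases y) simp
  ultimately show "{x, y} \<in> edges (disjoint_copies t L)"
    unfolding disjoint_copies_def hypergraph.select_convs by blast
qed

text \<open>Edges are two-element sets, so matching adjacency pair by pair matches the edge sets.
  Links are compared in this form because disjoint cliques are easiest to describe by
  adjacency.\<close>

lemma isomorphic_if_adj:
  assumes G: "simple_graph G" and G': "simple_graph G'"
    and f: "bij_betw f (verts G) (verts G')"
    and adj: "\<And>u v. u \<in> verts G \<Longrightarrow> v \<in> verts G \<Longrightarrow> {u, v} \<in> edges G \<longleftrightarrow> {f u, f v} \<in> edges G'"
  shows "isomorphic G G'"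
  unfolding isomorphic_def
proof (intro exI conjI)
  show "(\<lambda>e. f ` e) ` edges G = edges G'"
  proof (intro equalityI subsetI)
    fix e assume "e \<in> (\<lambda>e. f ` e) ` edges G"
    then obtain e0 where e0: "e0 \<in> edges G" "e = f ` e0" by blast
    then have "e0 \<subseteq> verts G" "card e0 = 2"
      using G by (auto simp: simple_graph_def)
    then obtain u v where "e0 = {u, v}" "u \<in> verts G" "v \<in> verts G"
      by (auto simp: card_2_iff)
    then show "e \<in> edges G'" using adj e0 by auto
  next
    fix e assume e: "e \<in> edges G'"
    then have "e \<subseteq> verts G'" "card e = 2"
      using G' by (auto simp: simple_graph_def)
    then obtain u' v' where uv': "e = {u', v'}" "u' \<in> verts G'" "v' \<in> verts G'"
      by (auto simp: card_2_iff)
    then obtain u v where "u \<in> verts G" "v \<in> verts G" "u' = f u" "v' = f v"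
      using f unfolding bij_betw_def by blast
    then have "{u, v} \<in> edges G" "e = f ` {u, v}"
      using adj e uv' by auto
    then show "e \<in> (\<lambda>e. f ` e) ` edges G" by blast
  qed
qed (fact f)

text \<open>Injectivity on vertices passes to edges, so an image edge has only one possible
  preimage. This turns the link isomorphism known for the old graph into adjacency data that can be
  extended.\<close>

lemma isomorphic_adjE:
  assumes "isomorphic G G'" "simple_graph G"
  obtains f where "bij_betw f (verts G) (verts G')"
    "\<And>u v. u \<in> verts G \<Longrightarrow> v \<in> verts G \<Longrightarrow> {f u, f v} \<in> edges G' \<longleftrightarrow> {u, v} \<in> edges G"
proof -
  obtain f where f: "bij_betw f (verts G) (verts G')" "(\<lambda>e. f ` e) ` edges G = edges G'"
    using assms(1) by (auto simp: isomorphic_def)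
  have "{f u, f v} \<in> edges G' \<longleftrightarrow> {u, v} \<in> edges G" if "u \<in> verts G" "v \<in> verts G" for u v
  proof
    assume "{f u, f v} \<in> edges G'"
    then obtain e where e: "e \<in> edges G" "f ` {u, v} = f ` e"
      unfolding f(2)[symmetric] by auto
    moreover have "e \<subseteq> verts G"
      using e assms(2) by (auto simp: simple_graph_def)
    ultimately have "{u, v} = e"
      using f(1) that inj_on_image_eq_iff[of f "verts G" "{u, v}" e] by (simp add: bij_betw_def)
    then show "{u, v} \<in> edges G" using e by simp
  next
    assume "{u, v} \<in> edges G"
    then have "f ` {u, v} \<in> edges G'"
      unfolding f(2)[symmetric] by (rule imageI)
    then show "{f u, f v} \<in> edges G'" by simp
  qed
  then show thesis using that f(1) by blast
qed

text \<open>Settles the initial graph: K_q has too few vertices once q is less than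
  \<open>l\<close>.\<close>

lemma cycle_free_if_card_less:
  assumes "finite (verts G)" "card (verts G) < l"
  shows "cycle_free l G"
proof -
  have "length c \<le> card (verts G)" if "distinct c" "set c \<subseteq> verts G" for c
    using that assms card_mono distinct_card by metis
  then show ?thesis
    using assms unfolding cycle_free_def by (metis not_less)
qed

text \<open>Meant for the map from \<Gamma> to the labels in \<open>G\<close>, which is injective on
  each copy but not globally; hence injectivity is asked on the cycle alone.\<close>

lemma cycle_free_pullback:
  assumes "cycle_free l G" "3 \<le> l" "length c = l" "distinct c" "inj_on f (set c)"
    "f ` set c \<subseteq> verts G"
  shows "\<exists>i<l. {f (c ! i), f (c ! (Suc i mod l))} \<notin> edges G"
proof (rule ccontr)
  assume "\<not> ?thesis"
  then have "length (map f c) = l \<and> 3 \<le> l \<and> distinct (map f c) \<and> set (map f c) \<subseteq> verts G \<and>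
      (\<forall>i<l. {map f c ! i, map f c ! (Suc i mod l)} \<in> edges G)"
    using assms by (auto simp: distinct_map)
  then show False
    using assms(1) unfolding cycle_free_def by blast
qed

section \<open>Short cycles whose edges preserve the copy or the clique\<close>

text \<open>
  Here \<open>p\<close> gives the copy and \<open>c\<close> the clique of a vertex. A mixed cycle of length at most 5
  has at most two maximal \<open>p\<close>-runs and two maximal \<open>c\<close>-runs; the assumption \<open>linear\<close> says that
  two lines with two common points coincide.
\<close>

lemma short_cycle_monochromatic:
  fixes p :: "'v \<Rightarrow> 'p" and c :: "'v \<Rightarrow> 'c"
  assumes inj: "\<And>u v. u \<in> V \<Longrightarrow> v \<in> V \<Longrightarrow> p u = p v \<Longrightarrow> c u = c v \<Longrightarrow> u = v"
    and linear: "\<And>a b a' b'. a \<in> V \<Longrightarrow> b \<in> V \<Longrightarrow> a' \<in> V \<Longrightarrow> b' \<in> V \<Longrightarrow>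
       c a = c b \<Longrightarrow> p a = p a' \<Longrightarrow> p b = p b' \<Longrightarrow> c a' = c b' \<Longrightarrow> p a \<noteq> p b \<Longrightarrow> c a = c a'"
    and l: "length xs = l" "l = 4 \<or> l = 5" and xs: "distinct xs" "set xs \<subseteq> V"
    and adj: "\<And>i. i < l \<Longrightarrow> p (xs ! i) = p (xs ! (Suc i mod l)) \<or> c (xs ! i) = c (xs ! (Suc i mod l))"
  shows "(\<exists>a. \<forall>x\<in>set xs. p x = a) \<or> (\<exists>b. \<forall>x\<in>set xs. c x = b)"
  using l(2)
proof
  assume "l = 4"
  then obtain v0 v1 v2 v3 where xs_eq: "xs = [v0, v1, v2, v3]"
    using l(1) by (auto simp: length_Suc_conv numeral_eq_Suc)
  have "p v0 = p v1 \<or> c v0 = c v1" "p v1 = p v2 \<or> c v1 = c v2" "p v2 = p v3 \<or> c v2 = c v3"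
    "p v3 = p v0 \<or> c v3 = c v0"
    using adj[of 0] adj[of 1] adj[of 2] adj[of 3] \<open>l = 4\<close> xs_eq by simp_all
  moreover have "v0 \<in> V" "v1 \<in> V" "v2 \<in> V" "v3 \<in> V" "distinct [v0, v1, v2, v3]"
    using xs xs_eq by auto
  \<comment> \<open>If there is one run of each kind, its ends agree in both \<open>p\<close> and
    \<open>c\<close>, against \<open>inj\<close>. If there are two of each, \<open>linear\<close>
    identifies the two cliques, and then \<open>inj\<close> identifies the ends of a
    \<open>p\<close>-run.\<close>
  ultimately have "p v0 = p v1 \<and> p v1 = p v2 \<and> p v2 = p v3 \<or> c v0 = c v1 \<and> c v1 = c v2 \<and> c v2 = c v3"
    using inj linear by (smt (verit) distinct_length_2_or_more)
  then show ?thesis using xs_eq by auto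
next
  assume "l = 5"
  then obtain v0 v1 v2 v3 v4 where xs_eq: "xs = [v0, v1, v2, v3, v4]"
    using l(1) by (auto simp: length_Suc_conv numeral_eq_Suc)
  have "p v0 = p v1 \<or> c v0 = c v1" "p v1 = p v2 \<or> c v1 = c v2" "p v2 = p v3 \<or> c v2 = c v3"
    "p v3 = p v4 \<or> c v3 = c v4" "p v4 = p v0 \<or> c v4 = c v0"
    using adj[of 0] adj[of 1] adj[of 2] adj[of 3] adj[of 4] \<open>l = 5\<close> xs_eq by simp_all
  moreover have "v0 \<in> V" "v1 \<in> V" "v2 \<in> V" "v3 \<in> V" "v4 \<in> V" "distinct [v0, v1, v2, v3, v4]"
    using xs xs_eq by auto
  \<comment> \<open>The same alternatives as for length 4: a fifth vertex can only lengthen a run,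
    as three runs of each kind would need six edges.\<close>
  ultimately have "p v0 = p v1 \<and> p v1 = p v2 \<and> p v2 = p v3 \<and> p v3 = p v4 \<or>
      c v0 = c v1 \<and> c v1 = c v2 \<and> c v2 = c v3 \<and> c v3 = c v4"
    using inj linear by (smt (verit) distinct_length_2_or_more)
  then show ?thesis using xs_eq by auto
qed

section \<open>The graph \<Gamma> over a linear uniform hypergraph\<close>

text \<open>Collects what \<Gamma> needs of \<open>H\<close>, free of coordinates; affine geometry
  enters only when the locale is interpreted.\<close>

locale Gamma_construction =
  fixes G :: "'v hypergraph" and H :: "'p hypergraph"
    and lab :: "'p \<Rightarrow> nat \<Rightarrow> 'v" and En :: "'p \<Rightarrow> nat \<Rightarrow> 'p set" and q :: nat
  assumes simple_G: "simple_graph G"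
    and finite_H: "finite (verts H)"
    and edge_subset: "E \<in> edges H \<Longrightarrow> E \<subseteq> verts H"
    and uniform: "E \<in> edges H \<Longrightarrow> card E = q"
    and linear: "E \<in> edges H \<Longrightarrow> E' \<in> edges H \<Longrightarrow> x \<in> E \<inter> E' \<Longrightarrow> y \<in> E \<inter> E' \<Longrightarrow> x \<noteq> y \<Longrightarrow> E = E'"
    and lab: "x \<in> verts H \<Longrightarrow> bij_betw (lab x) {1..card (verts G)} (verts G)"
    and En: "x \<in> verts H \<Longrightarrow> bij_betw (En x) {1..card (verts G)} {E \<in> edges H. x \<in> E}"
begin

abbreviation n :: nat where "n \<equiv> card (verts G)"

abbreviation \<Gamma> :: "('p \<times> nat) hypergraph" where "\<Gamma> \<equiv> Gamma_graph G H lab En"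

definition label :: "'p \<times> nat \<Rightarrow> 'v" where "label u = lab (fst u) (snd u)"

text \<open>With \<open>fst\<close> as \<open>p\<close> and this map as \<open>c\<close>, the
  vertices of \<Gamma> meet the hypotheses of \<open>short_cycle_monochromatic\<close>.\<close>

definition clique_edge :: "'p \<times> nat \<Rightarrow> 'p set" where "clique_edge u = En (fst u) (snd u)"

lemma verts_Gamma: "verts \<Gamma> = verts H \<times> {1..n}"
  by (simp add: Gamma_graph_def Let_def)

lemma finite_Gamma: "finite (verts \<Gamma>)"
  by (simp add: verts_Gamma finite_H)

lemma card_Gamma: "card (verts \<Gamma>) = card (verts H) * n"
  by (simp add: verts_Gamma card_cartesian_product)

lemma clique_edge_in: "u \<in> verts \<Gamma> \<Longrightarrow> clique_edge u \<in> edges H \<and> fst u \<in> clique_edge u"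
  using En[THEN bij_betwE] by (auto simp: verts_Gamma clique_edge_def)

lemma clique_edge_inj:
  assumes "u \<in> verts \<Gamma>" "v \<in> verts \<Gamma>" "fst u = fst v" "clique_edge u = clique_edge v"
  shows "u = v"
  using assms inj_onD[OF En[THEN bij_betw_imp_inj_on], of "fst u" "snd u" "snd v"]
  by (auto simp: verts_Gamma clique_edge_def)

lemma label_in: "u \<in> verts \<Gamma> \<Longrightarrow> label u \<in> verts G"
  using lab[THEN bij_betwE] by (auto simp: verts_Gamma label_def)

lemma label_inj:
  assumes "u \<in> verts \<Gamma>" "v \<in> verts \<Gamma>" "fst u = fst v" "label u = label v"
  shows "u = v"
  using assms inj_onD[OF lab[THEN bij_betw_imp_inj_on], of "fst u" "snd u" "snd v"]
  by (auto simp: verts_Gamma label_def)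

lemma clique_set_eq: "clique_set n H En E = {u \<in> verts \<Gamma>. clique_edge u = E}"
  by (auto simp: clique_set_def verts_Gamma clique_edge_def)

text \<open>Surjectivity of \<open>En x\<close> puts a clique vertex over every point
  \<open>x\<close> of \<open>E\<close>, injectivity at most one; so cliques inherit the size of
  hyperedges.\<close>

lemma fst_clique:
  assumes E: "E \<in> edges H"
  shows "bij_betw fst {u \<in> verts \<Gamma>. clique_edge u = E} E"
proof (rule bij_betw_imageI)
  show "inj_on fst {u \<in> verts \<Gamma>. clique_edge u = E}"
    using clique_edge_inj by (auto simp: inj_on_def)
  show "fst ` {u \<in> verts \<Gamma>. clique_edge u = E} = E"
  proof (intro equalityI subsetI)
    fix x assume x: "x \<in> E"
    then have "x \<in> verts H" using E edge_subset by blast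
    moreover from this obtain j where "j \<in> {1..n}" "En x j = E"
      using En E x unfolding bij_betw_def by (smt (verit) imageE mem_Collect_eq)
    ultimately have "(x, j) \<in> {u \<in> verts \<Gamma>. clique_edge u = E}"
      by (simp add: verts_Gamma clique_edge_def)
    then show "x \<in> fst ` {u \<in> verts \<Gamma>. clique_edge u = E}" by force
  qed (use clique_edge_in in auto)
qed

lemma card_clique: "E \<in> edges H \<Longrightarrow> card {u \<in> verts \<Gamma>. clique_edge u = E} = q"
  using bij_betw_same_card[OF fst_clique] uniform by simp

text \<open>Vertices of one clique lying in the same copy coincide, so distinctness of clique mates
  can be tested on \<open>fst\<close>. This makes the two kinds of edges mutually exclusive.\<close>

lemma Gamma_adj:
  "{u, v} \<in> edges \<Gamma> \<longleftrightarrow> u \<in> verts \<Gamma> \<and> v \<in> verts \<Gamma> \<and>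
     (fst u = fst v \<and> {label u, label v} \<in> edges G \<or>
      fst u \<noteq> fst v \<and> clique_edge u = clique_edge v)" (is "_ \<longleftrightarrow> ?R")
proof -
  have "{u, v} \<in> edges \<Gamma> \<longleftrightarrow>
      (\<exists>x i j. {u, v} = {(x, i), (x, j)} \<and> x \<in> verts H \<and> i \<in> {1..n} \<and> j \<in> {1..n} \<and>
        {lab x i, lab x j} \<in> edges G) \<or>
      (\<exists>E\<in>edges H. {u, v} \<in> edges (complete_graph {u \<in> verts \<Gamma>. clique_edge u = E}))"
    unfolding clique_set_eq[symmetric] by (simp add: Gamma_graph_def Let_def)
  also have "(\<exists>x i j. {u, v} = {(x, i), (x, j)} \<and> x \<in> verts H \<and> i \<in> {1..n} \<and> j \<in> {1..n} \<and>
        {lab x i, lab x j} \<in> edges G) \<longleftrightarrow>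
      u \<in> verts \<Gamma> \<and> v \<in> verts \<Gamma> \<and> fst u = fst v \<and> {label u, label v} \<in> edges G"
    by (cases u; cases v) (auto simp: verts_Gamma label_def doubleton_eq_iff insert_commute)
  also have "(\<exists>E\<in>edges H. {u, v} \<in> edges (complete_graph {u \<in> verts \<Gamma>. clique_edge u = E})) \<longleftrightarrow>
      u \<in> verts \<Gamma> \<and> v \<in> verts \<Gamma> \<and> fst u \<noteq> fst v \<and> clique_edge u = clique_edge v"
    unfolding complete_graph_adj using clique_edge_in[of u] clique_edge_inj[of u v] by auto
  finally show ?thesis by blast
qed

lemma simple_Gamma: "simple_graph \<Gamma>"
  unfolding simple_graph_def
proof (intro conjI ballI)
  fix e assume e: "e \<in> edges \<Gamma>"
  obtain u v where uv: "e = {u, v}"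
    using e by (auto simp: Gamma_graph_def Let_def complete_graph_def card_2_iff)
  then have "u \<in> verts \<Gamma>" "v \<in> verts \<Gamma>" "u \<noteq> v"
    using e Gamma_adj[of u v] simple_graph_adj_neq[OF simple_G] by auto
  then show "e \<subseteq> verts \<Gamma>" "card e = 2" using uv by auto
qed (rule finite_Gamma)

lemma short_cycle_free_Gamma:
  assumes l: "l = 4 \<or> l = 5" and "q < l" and free: "cycle_free l G"
  shows "cycle_free l \<Gamma>"
  unfolding cycle_free_def
proof (rule notI, elim exE conjE)
  fix xs assume xs: "length xs = l" "3 \<le> l" "distinct xs" "set xs \<subseteq> verts \<Gamma>"
    and adj: "\<forall>i<l. {xs ! i, xs ! (Suc i mod l)} \<in> edges \<Gamma>"
  have "(\<exists>a. \<forall>x\<in>set xs. fst x = a) \<or> (\<exists>b. \<forall>x\<in>set xs. clique_edge x = b)"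
  proof (rule short_cycle_monochromatic[OF _ _ xs(1) l xs(3,4)])
    fix i assume "i < l"
    then show "fst (xs ! i) = fst (xs ! (Suc i mod l)) \<or>
        clique_edge (xs ! i) = clique_edge (xs ! (Suc i mod l))"
      using adj Gamma_adj by blast
  next
    fix a b a' b'
    assume *: "a \<in> verts \<Gamma>" "b \<in> verts \<Gamma>" "a' \<in> verts \<Gamma>" "b' \<in> verts \<Gamma>"
      "clique_edge a = clique_edge b" "fst a = fst a'" "fst b = fst b'"
      "clique_edge a' = clique_edge b'" "fst a \<noteq> fst b"
    show "clique_edge a = clique_edge a'"
      \<comment> \<open>The hyperedges of \<open>a\<close> and \<open>a'\<close> both pass through
        the distinct points \<open>fst a\<close> and \<open>fst b\<close>.\<close>
      by (rule linear[of _ _ "fst a" "fst b"]) (use * clique_edge_in in \<open>metis IntI\<close>)+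
  qed (rule clique_edge_inj)
  then consider a where "\<forall>x\<in>set xs. fst x = a" | b where "\<forall>x\<in>set xs. clique_edge x = b"
    by blast
  then show False
  proof cases
    case 1
    \<comment> \<open>Inside one copy labels are distinct, so the cycle would project to an equally
      long cycle in \<open>G\<close>.\<close>
    have "inj_on label (set xs)"
    proof (rule inj_onI)
      fix u v assume "u \<in> set xs" "v \<in> set xs" "label u = label v"
      then show "u = v"
        using label_inj[of u v] 1 xs(4) by auto
    qed
    then obtain i where i: "i < l" "{label (xs ! i), label (xs ! (Suc i mod l))} \<notin> edges G"
      using cycle_free_pullback[OF free xs(2,1,3), of label] label_in xs(4) by blast
    moreover have "xs ! i \<in> set xs" "xs ! (Suc i mod l) \<in> set xs"
      using i(1) xs(1) by simp_all
    ultimately show False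
      using adj Gamma_adj 1 by metis
  next
    case 2
    let ?K = "{u \<in> verts \<Gamma>. clique_edge u = b}"
    obtain x where "x \<in> set xs" using xs(1,2) by (cases xs) auto
    then have "b \<in> edges H"
      using 2 xs(4) clique_edge_in[of x] by auto
    then have "card ?K = q" by (rule card_clique)
    moreover have "card (set xs) \<le> card ?K"
      by (rule card_mono) (use 2 xs(4) finite_Gamma in auto)
    ultimately show False
      using xs distinct_card[of xs] \<open>q < l\<close> by simp
  qed
qed

lemma constant_link_Gamma:
  assumes link: "constant_link G (disjoint_copies s (complete_graph {..<q - 1}))"
  shows "constant_link \<Gamma> (disjoint_copies (Suc s) (complete_graph {..<q - 1}))"
  unfolding constant_link_def
proof
  fix w assume w: "w \<in> verts \<Gamma>"
  let ?K = "complete_graph {..<q - 1}"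
  let ?Lw = "induced_subgraph G (neighborhood G (label w))"
  \<comment> \<open>The neighbours of \<open>w\<close> split into its clique mates \<open>?C\<close>
    and its neighbours \<open>?B\<close> within its own copy.\<close>
  let ?C = "{u \<in> verts \<Gamma>. clique_edge u = clique_edge w} - {w}"
  let ?B = "{u \<in> verts \<Gamma>. fst u = fst w \<and> {label w, label u} \<in> edges G}"
  have "isomorphic ?Lw (disjoint_copies s ?K)"
    using link label_in[OF w] by (simp add: constant_link_def)
  moreover have "verts (disjoint_copies s ?K) = {..<s} \<times> {..<q - 1}"
    by (simp add: disjoint_copies_def complete_graph_def)
  ultimately obtain f where f: "bij_betw f (verts ?Lw) ({..<s} \<times> {..<q - 1})"
    and f_adj: "\<And>u v. u \<in> verts ?Lw \<Longrightarrow> v \<in> verts ?Lw \<Longrightarrow>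
        {f u, f v} \<in> edges (disjoint_copies s ?K) \<longleftrightarrow> {u, v} \<in> edges ?Lw"
    using simple_graph_induced[OF simple_G] by (elim isomorphic_adjE) auto
  have "card ?C = q - 1"
    using w card_clique clique_edge_in finite_Gamma by (simp add: card_Diff_singleton)
  then obtain h where h: "bij_betw h ?C {..<q - 1}"
    using finite_same_card_bij[of ?C "{..<q - 1}"] finite_Gamma by auto
  \<comment> \<open>Neighbours in the copy keep the numbers below \<open>s\<close> given by
    \<open>f\<close>; clique mates get the new number \<open>s\<close>. Testing \<open>fst\<close>
    separates the two, as no clique mate shares the copy of \<open>w\<close>.\<close>
  define g where "g u = (if fst u = fst w then f (label u) else (s, h u))" for u
  have nbhd: "neighborhood \<Gamma> w = ?B \<union> ?C"
    using clique_edge_inj[OF _ w] w unfolding neighborhood_def Gamma_adj by fastforce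
  have fst_C: "fst u \<noteq> fst w" if "u \<in> ?C" for u
    using that clique_edge_inj[OF _ w] by blast
  have verts_Lw: "verts ?Lw = {a \<in> verts G. {label w, a} \<in> edges G}"
    by (auto simp: induced_subgraph_def neighborhood_def)
  have B: "bij_betw label ?B (verts ?Lw)"
  proof (rule bij_betw_imageI)
    show "inj_on label ?B"
      using label_inj by (auto simp: inj_on_def)
    show "label ` ?B = verts ?Lw"
    proof (intro equalityI subsetI)
      fix a assume a: "a \<in> verts ?Lw"
      have "fst w \<in> verts H" using w by (auto simp: verts_Gamma)
      then obtain j where "j \<in> {1..n}" "lab (fst w) j = a"
        using bij_betw_imp_surj_on[OF lab] a unfolding verts_Lw
        by (metis (no_types, lifting) imageE mem_Collect_eq)
      then have "(fst w, j) \<in> ?B" "label (fst w, j) = a"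
        using a \<open>fst w \<in> verts H\<close> unfolding verts_Lw by (auto simp: label_def verts_Gamma)
      then show "a \<in> label ` ?B" by blast
    qed (use label_in in \<open>auto simp: verts_Lw\<close>)
  qed
  have gB: "bij_betw g ?B ({..<s} \<times> {..<q - 1})"
    using bij_betw_trans[OF B f] by (rule bij_betw_cong[THEN iffD1, rotated]) (auto simp: g_def)
  have gC: "bij_betw g ?C ({s} \<times> {..<q - 1})"
  proof -
    have "bij_betw (Pair s) {..<q - 1} ({s} \<times> {..<q - 1})"
      by (auto simp: bij_betw_def inj_on_def)
    from bij_betw_trans[OF h this] show ?thesis
      by (rule bij_betw_cong[THEN iffD1, rotated]) (use fst_C in \<open>auto simp: g_def\<close>)
  qed
  have g: "bij_betw g (?B \<union> ?C) ({..<Suc s} \<times> {..<q - 1})"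
  proof -
    have "bij_betw g (?B \<union> ?C) ({..<s} \<times> {..<q - 1} \<union> {s} \<times> {..<q - 1})"
      by (rule bij_betw_combine[OF gB gC]) auto
    moreover have "{..<s} \<times> {..<q - 1} \<union> {s} \<times> {..<q - 1} = {..<Suc s} \<times> {..<q - 1}"
      by auto
    ultimately show ?thesis by simp
  qed
  let ?L = "induced_subgraph \<Gamma> (neighborhood \<Gamma> w)"
  have verts_L: "verts ?L = ?B \<union> ?C"
    unfolding nbhd[symmetric] by (auto simp: induced_subgraph_def neighborhood_def)
  show "isomorphic ?L (disjoint_copies (Suc s) ?K)"
  proof (rule isomorphic_if_adj)
    show "bij_betw g (verts ?L) (verts (disjoint_copies (Suc s) ?K))"
      using g unfolding verts_L by (simp add: disjoint_copies_def complete_graph_def)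
  next
    fix u v assume uv: "u \<in> verts ?L" "v \<in> verts ?L"
    have L_adj: "{u, v} \<in> edges ?L \<longleftrightarrow> {u, v} \<in> edges \<Gamma>"
      using uv by (auto simp: induced_subgraph_def)
    have inV: "u \<in> verts \<Gamma>" "v \<in> verts \<Gamma>"
      using uv unfolding verts_L by auto
    have fst_gB: "fst (g a) < s" if "a \<in> ?B" for a
      using bspec[OF bij_betwE[OF gB] that] by (simp add: mem_Times_iff)
    have fst_gC: "fst (g a) = s" if "a \<in> ?C" for a
      using bspec[OF bij_betwE[OF gC] that] by (simp add: mem_Times_iff)
    have g_BB: "{g u, g v} \<in> edges (disjoint_copies (Suc s) ?K) \<longleftrightarrow>
        {g u, g v} \<in> edges (disjoint_copies s ?K)" if "u \<in> ?B"
      using fst_gB[OF that] by (simp add: disjoint_copies_adj)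
    consider "u \<in> ?B" "v \<in> ?B" | "u \<in> ?B" "v \<in> ?C" | "u \<in> ?C" "v \<in> ?B" | "u \<in> ?C" "v \<in> ?C"
      using uv unfolding verts_L by blast
    then show "{u, v} \<in> edges ?L \<longleftrightarrow> {g u, g v} \<in> edges (disjoint_copies (Suc s) ?K)"
    proof cases
      case 1
      then have "label u \<in> verts ?Lw" "label v \<in> verts ?Lw"
        using bij_betwE[OF B] by blast+
      then have "{label u, label v} \<in> edges ?Lw \<longleftrightarrow> {g u, g v} \<in> edges (disjoint_copies s ?K)"
        using f_adj 1 by (simp add: g_def)
      moreover have "{label u, label v} \<in> edges ?Lw \<longleftrightarrow> {label u, label v} \<in> edges G"
        using \<open>label u \<in> verts ?Lw\<close> \<open>label v \<in> verts ?Lw\<close> by (auto simp: induced_subgraph_def)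
      ultimately show ?thesis
        using 1 g_BB L_adj Gamma_adj by auto
    next
      case 2
      \<comment> \<open>Otherwise \<open>u\<close> would share both copy and clique with
        \<open>w\<close>, hence equal \<open>w\<close>, and \<open>label w\<close> would be adjacent
        to itself.\<close>
      have "\<not> clique_edge u = clique_edge v"
        using 2 clique_edge_inj[OF inV(1) w] simple_graph_adj_neq(1)[OF simple_G] by auto
      then have "{u, v} \<notin> edges \<Gamma>"
        using 2 fst_C[of v] Gamma_adj[of u v] by auto
      moreover have "{g u, g v} \<notin> edges (disjoint_copies (Suc s) ?K)"
        using fst_gB[OF 2(1)] fst_gC[OF 2(2)] by (simp add: disjoint_copies_adj)
      ultimately show ?thesis using L_adj by simp
    next
      case 3
      have "\<not> clique_edge u = clique_edge v"
        using 3 clique_edge_inj[OF inV(2) w] simple_graph_adj_neq(1)[OF simple_G] by auto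
      then have "{u, v} \<notin> edges \<Gamma>"
        using 3 fst_C[of u] Gamma_adj[of u v] by auto
      moreover have "{g u, g v} \<notin> edges (disjoint_copies (Suc s) ?K)"
        using fst_gB[OF 3(2)] fst_gC[OF 3(1)] by (simp add: disjoint_copies_adj)
      ultimately show ?thesis using L_adj by simp
    next
      case 4
      \<comment> \<open>Distinct clique mates lie in different copies and are therefore joined by a
        clique edge.\<close>
      have "{u, v} \<in> edges \<Gamma> \<longleftrightarrow> u \<noteq> v"
        using 4 clique_edge_inj[OF inV] simple_graph_adj_neq(1)[OF simple_G] Gamma_adj[of u v]
        by auto
      also have "\<dots> \<longleftrightarrow> h u \<noteq> h v"
        using bij_betw_imp_inj_on[OF h] 4 by (auto dest: inj_onD)
      also have "\<dots> \<longleftrightarrow> {g u, g v} \<in> edges (disjoint_copies (Suc s) ?K)"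
        using fst_C[OF 4(1)] fst_C[OF 4(2)] bij_betwE[OF h] 4
        by (simp add: g_def disjoint_copies_adj complete_graph_adj)
      finally show ?thesis using L_adj by simp
    qed
  qed (simp_all add: simple_graph_induced simple_Gamma simple_graph_disjoint_copies
      simple_graph_complete)
qed

end

text \<open>Base of the induction: removing a vertex of K_q leaves a single K_(q-1), which gets the
  copy number 0.\<close>

lemma constant_link_complete_graph:
  assumes "finite S" "card S = q"
  shows "constant_link (complete_graph S) (disjoint_copies 1 (complete_graph {..<q - 1}))"
  unfolding constant_link_def
proof
  fix v assume "v \<in> verts (complete_graph S)"
  then have v: "v \<in> S" by (simp add: complete_graph_def)
  let ?L = "induced_subgraph (complete_graph S) (neighborhood (complete_graph S) v)"
  have verts_L: "verts ?L = S - {v}"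
    unfolding induced_subgraph_def neighborhood_def complete_graph_adj
    using v by (auto simp: complete_graph_def)
  have "card (S - {v}) = q - 1" using assms v by simp
  then obtain h where h: "bij_betw h (S - {v}) {..<q - 1}"
    using finite_same_card_bij[of "S - {v}" "{..<q - 1}"] assms by auto
  show "isomorphic ?L (disjoint_copies 1 (complete_graph {..<q - 1}))"
  proof (rule isomorphic_if_adj)
    have "bij_betw (Pair 0) {..<q - 1} ({..<1::nat} \<times> {..<q - 1})"
      by (auto simp: bij_betw_def inj_on_def)
    from bij_betw_trans[OF h this]
    show "bij_betw (Pair 0 \<circ> h) (verts ?L) (verts (disjoint_copies 1 (complete_graph {..<q - 1})))"
      unfolding verts_L by (simp add: disjoint_copies_def complete_graph_def)
  next
    fix u w assume uw: "u \<in> verts ?L" "w \<in> verts ?L"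
    then have "{u, w} \<in> edges ?L \<longleftrightarrow> {u, w} \<in> edges (complete_graph S)"
      by (auto simp: induced_subgraph_def)
    also have "\<dots> \<longleftrightarrow> h u \<noteq> h w"
      using uw bij_betw_imp_inj_on[OF h] unfolding verts_L complete_graph_adj
      by (auto dest: inj_onD)
    also have "\<dots> \<longleftrightarrow> {(Pair 0 \<circ> h) u, (Pair 0 \<circ> h) w} \<in>
        edges (disjoint_copies 1 (complete_graph {..<q - 1}))"
      using uw bij_betwE[OF h] unfolding verts_L
      by (simp add: disjoint_copies_adj complete_graph_adj)
    finally show "{u, w} \<in> edges ?L \<longleftrightarrow> {(Pair 0 \<circ> h) u, (Pair 0 \<circ> h) w} \<in>
        edges (disjoint_copies 1 (complete_graph {..<q - 1}))" .
  qed (simp_all add: assms simple_graph_induced simple_graph_disjoint_copies simple_graph_complete)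
qed

section \<open>Affine lines and parallel classes\<close>

lemma bij_betw_points:
  "bij_betw (\<lambda>x. restrict x {..<m}) (points m) ({..<m} \<rightarrow>\<^sub>E (UNIV :: 'a::field set))"
  \<comment> \<open>The inverse refills with 0 from index \<open>m\<close> on, where the restricted
    function is \<open>undefined\<close>.\<close>
  by (rule bij_betw_byWitness[where f' = "\<lambda>x i. if i < m then x i else 0"])
    (auto simp: points_def restrict_def PiE_def extensional_def fun_eq_iff)

lemma finite_points: "finite (points m :: (nat \<Rightarrow> 'a::{field,finite}) set)"
  using bij_betw_finite[OF bij_betw_points[of m, where 'a = 'a]] by (simp add: finite_PiE)

lemma card_points: "card (points m :: (nat \<Rightarrow> 'a::{field,finite}) set) = CARD('a) ^ m"
  using bij_betw_same_card[OF bij_betw_points[of m, where 'a = 'a]] by (simp add: card_PiE)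

text \<open>Moving the base point along the line only shifts the parameter.\<close>

lemma line_through:
  assumes "x \<in> line p d"
  shows "line p d = line x d"
proof -
  obtain c where c: "x = (\<lambda>i. p i + c * d i)"
    using assms by (auto simp: line_def)
  have "(\<lambda>i. p i + k * d i) = (\<lambda>i. x i + (k - c) * d i)"
    and "(\<lambda>i. x i + k * d i) = (\<lambda>i. p i + (k + c) * d i)" for k
    by (auto simp: c algebra_simps)
  then show ?thesis unfolding line_def by blast
qed

text \<open>The difference of the two points is a nonzero multiple of \<open>d\<close>. Rescaling
  the parameter leaves a form depending on the two points alone, whence linearity of
  \<open>AG\<close>.\<close>

lemma line_through_two:
  assumes "x \<in> line p d" "y \<in> line p d" "x \<noteq> y"
  shows "line p d = line x (\<lambda>i. y i - x i)"
proof -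
  have eq: "line p d = line x d" using assms(1) by (rule line_through)
  then obtain c where c: "y = (\<lambda>i. x i + c * d i)"
    using assms(2) by (auto simp: line_def)
  then have "c \<noteq> 0" using assms(3) by auto
  then have "(\<lambda>i. x i + k * d i) = (\<lambda>i. x i + (k / c) * (y i - x i))"
    and "(\<lambda>i. x i + k * (y i - x i)) = (\<lambda>i. x i + (k * c) * d i)" for k
    by (auto simp: c)
  then show ?thesis unfolding eq unfolding line_def by blast
qed

lemma self_in_line: "p \<in> line p d"
  unfolding line_def by (rule range_eqI[of _ _ 0]) simp

lemma line_subset_points: "p \<in> points m \<Longrightarrow> d \<in> points m \<Longrightarrow> line p d \<subseteq> points m"
  by (auto simp: line_def points_def)

lemma translate_line: "(\<lambda>x i. x i + v i) ` line p d = line (\<lambda>i. p i + v i) d"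
  by (simp add: line_def image_image add_ac)

text \<open>A coordinate in which \<open>d\<close> does not vanish tells the parameters
  apart.\<close>

lemma card_line:
  fixes p d :: "nat \<Rightarrow> 'a::{field,finite}"
  assumes "d \<noteq> (\<lambda>i. 0)"
  shows "card (line p d) = CARD('a)"
proof -
  obtain i where "d i \<noteq> 0" using assms by auto
  then have "inj (\<lambda>c i. p i + c * d i)"
    by (intro injI) (auto dest: fun_cong[of _ _ i])
  then show ?thesis by (simp add: line_def card_image)
qed

lemma edges_AG_iff:
  "L \<in> edges (AG m) \<longleftrightarrow> (\<exists>p\<in>points m. \<exists>d\<in>points m. d \<noteq> (\<lambda>i. 0) \<and> L = line p d)"
  by (auto simp: AG_def)

lemma AG_linear:
  assumes "L \<in> edges (AG m)" "L' \<in> edges (AG m)" "x \<in> L \<inter> L'" "y \<in> L \<inter> L'" "x \<noteq> y"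
  shows "L = L'"
proof -
  have "L = line x (\<lambda>i. y i - x i)" "L' = line x (\<lambda>i. y i - x i)"
    using assms line_through_two[of x _ _ y] unfolding edges_AG_iff by blast+
  then show ?thesis by simp
qed

lemma translate_translate:
  fixes v w :: "nat \<Rightarrow> 'a::field"
  shows "(\<lambda>x i. x i + w i) ` (\<lambda>x i. x i + v i) ` L = (\<lambda>x i. x i + (v i + w i)) ` L"
  by (simp add: image_image add_ac)

text \<open>Translations by vectors of \<open>points m\<close> form a group: zero, negatives and
  sums give the three properties.\<close>

lemma equiv_parallel: "equiv (edges (AG m)) (parallel m :: ((nat \<Rightarrow> 'a::field) set \<times> _) set)"
  (is "equiv _ ?P")
proof (rule equivI)
  show "?P \<subseteq> edges (AG m) \<times> edges (AG m)"
    by (auto simp: parallel_def)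
  show "refl_on (edges (AG m)) ?P"
  proof (rule refl_onI)
    fix L :: "(nat \<Rightarrow> 'a) set" assume "L \<in> edges (AG m)"
    moreover have "\<exists>v\<in>points m. L = (\<lambda>x i. x i + v i) ` L"
      by (rule bexI[of _ "\<lambda>i. 0"]) (simp_all add: points_def)
    ultimately show "(L, L) \<in> ?P" by (simp add: parallel_def)
  qed
  show "sym ?P"
  proof (rule symI)
    fix L L' :: "(nat \<Rightarrow> 'a) set" assume "(L, L') \<in> ?P"
    then obtain v where v: "v \<in> points m" "L' = (\<lambda>x i. x i + v i) ` L"
      and L: "L \<in> edges (AG m)" "L' \<in> edges (AG m)"
      by (auto simp: parallel_def)
    have "L = (\<lambda>x i. x i + (- v i)) ` L'"
      unfolding v(2) translate_translate by simp
    moreover have "(\<lambda>i. - v i) \<in> points m" using v by (simp add: points_def)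
    ultimately have "\<exists>w\<in>points m. L = (\<lambda>x i. x i + w i) ` L'"
      by (rule bexI[where P = "\<lambda>w. L = (\<lambda>x i. x i + w i) ` L'"])
    then show "(L', L) \<in> ?P"
      using L by (simp add: parallel_def)
  qed
  show "trans ?P"
  proof (rule transI)
    fix L L' L'' :: "(nat \<Rightarrow> 'a) set" assume "(L, L') \<in> ?P" "(L', L'') \<in> ?P"
    then obtain v w where v: "v \<in> points m" "L' = (\<lambda>x i. x i + v i) ` L"
      and w: "w \<in> points m" "L'' = (\<lambda>x i. x i + w i) ` L'"
      and L: "L \<in> edges (AG m)" "L'' \<in> edges (AG m)"
      by (auto simp: parallel_def)
    have "L'' = (\<lambda>x i. x i + (v i + w i)) ` L"
      unfolding w(2) v(2) translate_translate ..
    moreover have "(\<lambda>i. v i + w i) \<in> points m" using v w by (simp add: points_def)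
    ultimately show "(L, L'') \<in> ?P" using L by (auto simp: parallel_def)
  qed
qed

text \<open>Translation keeps the direction, and a line is fixed by its direction and any one of its
  points.\<close>

lemma parallel_meet_eq:
  assumes "(L, L') \<in> parallel m" "x \<in> L" "x \<in> L'"
  shows "L = L'"
proof -
  obtain v p d where "L' = (\<lambda>x i. x i + v i) ` L" "L = line p d"
    using assms(1) by (auto simp: parallel_def edges_AG_iff)
  then have "L' = line (\<lambda>i. p i + v i) d" by (simp add: translate_line)
  then show ?thesis
    using \<open>L = line p d\<close> assms line_through by metis
qed

lemma parallel_through:
  assumes L: "L \<in> edges (AG m)" and x: "x \<in> points m"
  obtains L' where "(L, L') \<in> parallel m" "x \<in> L'"
proof -
  obtain p d where pd: "p \<in> points m" "d \<in> points m" "d \<noteq> (\<lambda>i. 0)" "L = line p d"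
    using L by (auto simp: edges_AG_iff)
  \<comment> \<open>This translation moves the base point \<open>p\<close> to
    \<open>x\<close>.\<close>
  define v where "v = (\<lambda>i. x i - p i)"
  have "v \<in> points m" using pd x by (simp add: v_def points_def)
  moreover have "line x d = (\<lambda>x i. x i + v i) ` L"
    unfolding pd(4) translate_line by (simp add: v_def)
  moreover have "line x d \<in> edges (AG m)"
    using pd x by (auto simp: edges_AG_iff)
  ultimately have "(L, line x d) \<in> parallel m"
    using L by (auto simp: parallel_def)
  then show thesis using that self_in_line by blast
qed

lemma induced_by_classes_verts: "induced_by_classes m n H \<Longrightarrow> verts H = points m"
  by (auto simp: induced_by_classes_def)

lemma induced_by_classes_edges: "induced_by_classes m n H \<Longrightarrow> edges H \<subseteq> edges (AG m)"
  using in_quotient_imp_subset[OF equiv_parallel]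
  by (fastforce simp: induced_by_classes_def parallel_classes_def)

text \<open>Each class partitions the points, so it has exactly one line through \<open>x\<close>;
  sending such a line to its class is a bijection onto the chosen classes.\<close>

lemma induced_by_classes_regular:
  assumes H: "induced_by_classes m n H" and x: "x \<in> points m"
  shows "card {E \<in> edges H. x \<in> E} = n"
proof -
  obtain C where C: "C \<subseteq> edges (AG m) // parallel m" "card C = n" "edges H = \<Union>C"
    using H by (auto simp: induced_by_classes_def parallel_classes_def)
  note eqv = equiv_parallel[of m, where 'a = 'a]
  \<comment> \<open>A chosen class is the class of each of its lines, whichever line represents
    it.\<close>
  have class_eq: "parallel m `` {E} = K" if "E \<in> K" "K \<in> C" for E K
  proof -
    obtain L where "K = parallel m `` {L}" using C(1) \<open>K \<in> C\<close> by (auto elim: quotientE)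
    then show ?thesis using equiv_class_eq[OF eqv] \<open>E \<in> K\<close> by blast
  qed
  have "bij_betw (\<lambda>E. parallel m `` {E}) {E \<in> edges H. x \<in> E} C"
  proof (rule bij_betw_imageI)
    show "inj_on (\<lambda>E. parallel m `` {E}) {E \<in> edges H. x \<in> E}"
    proof (rule inj_onI)
      fix E E' assume E: "E \<in> {E \<in> edges H. x \<in> E}" "E' \<in> {E \<in> edges H. x \<in> E}"
        and "parallel m `` {E} = parallel m `` {E'}"
      then have "(E, E') \<in> parallel m"
        using eq_equiv_class[OF _ eqv] induced_by_classes_edges[OF H] by blast
      then show "E = E'" using parallel_meet_eq E by blast
    qed
    show "(\<lambda>E. parallel m `` {E}) ` {E \<in> edges H. x \<in> E} = C"
    proof (intro equalityI subsetI)
      fix K assume K: "K \<in> C"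
      then obtain L where L: "L \<in> edges (AG m)" "K = parallel m `` {L}"
        using C(1) by (auto elim: quotientE)
      obtain E where "(L, E) \<in> parallel m" "x \<in> E"
        using parallel_through[OF L(1) x] by blast
      then have "E \<in> K" using L by blast
      then show "K \<in> (\<lambda>E. parallel m `` {E}) ` {E \<in> edges H. x \<in> E}"
        using class_eq K C(3) \<open>x \<in> E\<close> by blast
    qed (use class_eq C(3) in auto)
  qed
  then show ?thesis using C(2) bij_betw_same_card by blast
qed

section \<open>The construction over affine hypergraphs, and the induction on t\<close>

lemma Gamma_constructionI:
  fixes H :: "(nat \<Rightarrow> 'a::{field,finite}) hypergraph"
  assumes G: "simple_graph G" and H: "induced_by_classes m n H"
    and lab: "\<And>x. x \<in> verts H \<Longrightarrow> bij_betw (lab x) {1..card (verts G)} (verts G)"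
    and En: "\<And>x. x \<in> verts H \<Longrightarrow> bij_betw (En x) {1..card (verts G)} {E \<in> edges H. x \<in> E}"
  shows "Gamma_construction G H lab En CARD('a)"
proof
  note AG = subsetD[OF induced_by_classes_edges[OF H]]
  show "finite (verts H)"
    using induced_by_classes_verts[OF H] finite_points by metis
  show "E \<subseteq> verts H" if "E \<in> edges H" for E
    using AG[OF that] line_subset_points
    by (auto simp: edges_AG_iff induced_by_classes_verts[OF H])
  show "card E = CARD('a)" if "E \<in> edges H" for E
    using AG[OF that] card_line by (auto simp: edges_AG_iff)
  show "E = E'" if "E \<in> edges H" "E' \<in> edges H" "x \<in> E \<inter> E'" "y \<in> E \<inter> E'" "x \<noteq> y" for E E' x y
    using AG_linear[OF AG AG] that by blast
qed (use G lab En in auto)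

lemma is_Gamma_exists:
  fixes H :: "(nat \<Rightarrow> 'a::{field,finite}) hypergraph"
  assumes "finite (verts G)" and H: "induced_by_classes m (card (verts G)) H"
    and "card (verts G) > 0"
  shows "\<exists>G'. is_Gamma G H G'"
proof -
  have "\<exists>f. bij_betw f {1..card (verts G)} (verts G)"
    using assms(1) by (intro finite_same_card_bij) auto
  then obtain f where f: "bij_betw f {1..card (verts G)} (verts G)" ..
  have "\<forall>x\<in>verts H. \<exists>g. bij_betw g {1..card (verts G)} {E \<in> edges H. x \<in> E}"
  proof
    fix x assume "x \<in> verts H"
    then have "card {E \<in> edges H. x \<in> E} = card (verts G)"
      using induced_by_classes_regular[OF H] induced_by_classes_verts[OF H] by simp
    \<comment> \<open>Positive cardinality gives finiteness, because \<open>card\<close> is 0 on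
      infinite sets.\<close>
    then show "\<exists>g. bij_betw g {1..card (verts G)} {E \<in> edges H. x \<in> E}"
      using assms(3) card_ge_0_finite[of "{E \<in> edges H. x \<in> E}"]
      by (intro finite_same_card_bij) auto
  qed
  then obtain En where "\<forall>x\<in>verts H. bij_betw (En x) {1..card (verts G)} {E \<in> edges H. x \<in> E}"
    by metis
  then show ?thesis
    unfolding is_Gamma_def using f
    by (intro exI[of _ "Gamma_graph G H (\<lambda>_. f) En"] exI[of _ "\<lambda>_. f"] exI[of _ En]) simp
qed

text \<open>The induction carries simplicity, required by the construction, and one cycle statement
  for all sizes: for q = 3 it covers lengths 4 and 5, for q = 4 only 5. The bound
  \<open>t \<ge> 1\<close> is kept because \<open>H\<close> is constrained only from index 1
  on.\<close>

lemma is_A_properties: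
  fixes H :: "nat \<Rightarrow> (nat \<Rightarrow> 'a::{field,finite}) hypergraph"
  assumes H: "\<And>t. t \<ge> 1 \<Longrightarrow> induced_by_classes (2 ^ t) (CARD('a) ^ (2 ^ t - 1)) (H t)"
    and "is_A CARD('a) H t G"
  shows "t \<ge> 1 \<and> simple_graph G \<and> card (verts G) = CARD('a) ^ (2 ^ t - 1) \<and>
    constant_link G (disjoint_copies t (complete_graph {..<CARD('a) - 1})) \<and>
    (\<forall>l. (l = 4 \<or> l = 5) \<longrightarrow> CARD('a) < l \<longrightarrow> cycle_free l G)"
  using assms(2)
proof induction
  case (base S)
  have "verts (complete_graph S) = S" by (simp add: complete_graph_def)
  then show ?case
    using base constant_link_complete_graph[OF base] simple_graph_complete
    by (auto intro: cycle_free_if_card_less)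
next
  case (step i G G')
  have Hi: "induced_by_classes (2 ^ i) (CARD('a) ^ (2 ^ i - 1)) (H i)"
    using H step.IH by blast
  obtain lab En where
    lab: "\<And>x. x \<in> verts (H i) \<Longrightarrow> bij_betw (lab x) {1..card (verts G)} (verts G)"
    and En: "\<And>x. x \<in> verts (H i) \<Longrightarrow> bij_betw (En x) {1..card (verts G)} {E \<in> edges (H i). x \<in> E}"
    and G': "G' = Gamma_graph G (H i) lab En"
    using step.hyps(2) unfolding is_Gamma_def by blast
  interpret Gamma_construction G "H i" lab En "CARD('a)"
    using step.IH by (intro Gamma_constructionI[OF _ Hi lab En]) auto
  have "card (verts G') = CARD('a) ^ 2 ^ i * CARD('a) ^ (2 ^ i - 1)"
    using step.IH by (simp add: G' card_Gamma induced_by_classes_verts[OF Hi] card_points)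
  \<comment> \<open>The exponents add up to 2^i + 2^i - 1; truncated subtraction is harmless since
    2^i is positive.\<close>
  also have "\<dots> = CARD('a) ^ (2 ^ Suc i - 1)"
    by (simp add: mult_2 flip: power_add)
  finally show ?case
    using step.IH simple_Gamma constant_link_Gamma short_cycle_free_Gamma unfolding G' by auto
qed

text \<open>Keeps the claim about all such graphs from being vacuous. Enumerations exist at each
  step because \<open>is_A_properties\<close> makes the order of the current graph equal to the
  degree of \<open>H t\<close>.\<close>

lemma is_A_exists:
  fixes H :: "nat \<Rightarrow> (nat \<Rightarrow> 'a::{field,finite}) hypergraph"
  assumes H: "\<And>t. t \<ge> 1 \<Longrightarrow> induced_by_classes (2 ^ t) (CARD('a) ^ (2 ^ t - 1)) (H t)"
    and "t \<ge> 1"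
  shows "\<exists>G. is_A CARD('a) H t G"
  using assms(2)
proof (induction t rule: dec_induct)
  case base
  \<comment> \<open>All graphs of the sequence share one vertex type, so the initial clique must
    live there too; the \<open>nat\<close> factor supplies enough elements.\<close>
  have "infinite (UNIV :: ((nat \<Rightarrow> 'a) \<times> nat) set)"
    by (simp add: finite_prod)
  then obtain S :: "((nat \<Rightarrow> 'a) \<times> nat) set" where "finite S" "card S = CARD('a)"
    using infinite_arbitrarily_large by blast
  then show ?case using is_A.base by blast
next
  case (step t)
  then obtain G where G: "is_A CARD('a) H t G" by blast
  have props: "simple_graph G" "card (verts G) = CARD('a) ^ (2 ^ t - 1)"
    using is_A_properties[OF H G] by auto
  have "induced_by_classes (2 ^ t) (card (verts G)) (H t)"
    using H[OF step.hyps(1)] props by simp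
  then show ?case
    using is_Gamma_exists[of G "2 ^ t" "H t"] props is_A.step[OF G]
    by (auto simp: simple_graph_def)
qed

theorem theorem17:
  fixes q :: nat and H :: "nat \<Rightarrow> (nat \<Rightarrow> 'a::{field,finite}) hypergraph"
  assumes "primepow q" and "CARD('a) = q"
    and "\<And>t. t \<ge> 1 \<Longrightarrow> induced_by_classes (2 ^ t) (q ^ (2 ^ t - 1)) (H t)"
  shows "\<forall>t\<ge>1.
    (\<exists>G. is_A q H t G) \<and>
    (\<forall>G. is_A q H t G \<longrightarrow>
       simple_graph G \<and>
       card (verts G) = q ^ (2 ^ t - 1) \<and>
       constant_link G (disjoint_copies t (complete_graph {..<q - 1})) \<and>
       (q = 3 \<longrightarrow> cycle_free 4 G \<and> cycle_free 5 G) \<and>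
       (q = 4 \<longrightarrow> cycle_free 5 G))"
proof -
  note H = assms(3)[folded assms(2)]
  show ?thesis
    using is_A_exists[of H, OF H] is_A_properties[of H, OF H] unfolding assms(2) by auto
qed

end
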